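(* Let $\pi^{(1)},\dots,\pi^{(K)}$ be target policies in a finite-horizon MDP with horizon $T$, let $n_k$ ($k=1,\dots,K$) be the number of trajectories generated by $\pi^{(k)}$, and let $n=\sum_{k=1}^K n_k$. Let $\hat\mu$ be the behavior policy $\hat\mu_t(a|s)\propto\sqrt{\sum_{k=1}^K\pi^{(k)}_t(a|s)^2\hat q_{\pi^{(k)},t}(s,a)}$. Then for all $k\in\{1,\dots,K\}$, $t\in\{0,\dots,T-1\}$ and $s\in\mathcal S$, $$\mathbb V\left(E^{\mathrm{off},\pi^{(k)}}_{t:T-1}\,\middle|\,S_t=s\right)\le\mathbb V\left(E^{\mathrm{on},\pi^{(k)}}_{t:T-1}\,\middle|\,S_t=s\right),$$ if the similarity $\eta$ satisfies, for all $k$, $t$ and $s$, $$\sqrt{\frac{\overline\eta_t}{\underline\eta_t}}\left(\sum_a\pi^{(k)}_t(a|s)\sqrt{\hat q_{\pi^{(k)},t}(s,a)}\right)^2-\left(1-\frac{n_k}{n}\right)\Delta^{(k)}_t(s)\le\sum_a\pi^{(k)}_t(a|s)\,\hat q_{\pi^{(k)},t}(s,a),$$ where $$\Delta^{(k)}_t(s)=\mathbb E_{A_t\sim\hat\mu_t}\left[\left(\rho^{\pi^{(k)},\hat\mu}_t\right)^2\nu_{\pi^{(k)},t}(S_t,A_t)\,\middle|\,S_t=s\right]+\mathbb V_{A_t\sim\hat\mu_t}\left(\rho^{\pi^{(k)},\hat\mu}_t\,q_{\pi^{(k)},t}(S_t,A_t)\,\middle|\,S_t=s\right).$$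
   Context: Setting. A finite-horizon MDP has a finite state space $\mathcal S$, finite action space $\mathcal A$, deterministic reward function $r:\mathcal S\times\mathcal A\to\mathbb R$, transition probabilities $p(s'|s,a)$, and horizon $T$. A (time-dependent) policy is a family $\mu=(\mu_t)_{t=0}^{T-1}$ where $\mu_t(\cdot|s)$ is a probability distribution on $\mathcal A$ for every $s$. Under $\mu$, at time $t$, $A_t\sim\mu_t(\cdot|S_t)$, $R_{t+1}=r(S_t,A_t)$, $S_{t+1}\sim p(\cdot|S_t,A_t)$. There are $K$ target policies $\pi^{(1)},\dots,\pi^{(K)}$. Conditioning on $S_t=s$ means starting the process at time $t$ in state $s$. Value functions (undiscounted): $v_{\pi,t}(s)=\mathbb E_\pi[\sum_{i=t+1}^T R_i\mid S_t=s]$ and $q_{\pi,t}(s,a)=\mathbb E_\pi[\sum_{i=t+1}^T R_i\mid S_t=s,A_t=a]$. $\tau^{\mu_{t:T-1}}_{t:T-1}=\{S_t,A_t,R_{t+1},\dots,S_{T-1},A_{T-1},R_T\}$ denotes a random trajectory segment generated by $\mu$ from time $t$ to $T-1$. The per-decision importance sampling (PDIS) estimator for $\pi^{(k)}$ from data generated by $\mu$ is $$G^{\mathrm{PDIS}}_k\left(\tau^{\mu_{t:T-1}}_{t:T-1}\right)=\sum_{i=t}^{T-1}\left(\prod_{j=t}^{i}\rho^{\pi^{(k)},\mu}_j\right)R_{i+1},\qquad \rho^{\pi^{(k)},\mu}_j=\frac{\pi^{(k)}_j(A_j|S_j)}{\mu_j(A_j|S_j)}.$$ $\mathbb V$ denotes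 variance. Define $\nu_{\pi^{(k)},T-1}(s,a)=0$ and $\nu_{\pi^{(k)},t}(s,a)=\mathbb V\left(v_{\pi^{(k)},t+1}(S_{t+1})\mid S_t=s,A_t=a\right)$ for $t\le T-2$. Define $\hat q_{\pi^{(k)},T-1}(s,a)=q_{\pi^{(k)},T-1}(s,a)^2$, and for $t\le T-2$, $$\hat q_{\pi^{(k)},t}(s,a)=q_{\pi^{(k)},t}(s,a)^2+\nu_{\pi^{(k)},t}(s,a)+\sum_{s'}p(s'|s,a)\,\mathbb V\left(G^{\mathrm{PDIS}}_k\left(\tau^{\pi^{(k)}_{t+1:T-1}}_{t+1:T-1}\right)\,\middle|\,S_{t+1}=s'\right).$$ The notation $\mu(a)\propto f(a)$ with $f\ge0$ means $\mu(a)=f(a)/\sum_b f(b)$ (uniform if $f\equiv0$). Similarity: $w^{(k)}_t(s,a)=\pi^{(k)}_t(a|s)^2\hat q_{\pi^{(k)},t}(s,a)$, $\bar w_t(s,a)=\frac1K\sum_{j=1}^K w^{(j)}_t(s,a)$, $\eta^{(k)}_t(s,a)=w^{(k)}_t(s,a)/\bar w_t(s,a)$, $\underline\eta_t=\min_{k,s,a}\eta^{(k)}_t(s,a)$, $\overline\eta_t=\max_{k,s,a}\eta^{(k)}_t(s,a)$. Empirical averages: $E^{\mathrm{on},\pi^{(k)}}_{t:T-1}$ is the average of $G^{\mathrm{PDIS}}_k$ over $n_k$ independent trajectory segments (from time $t$ to $T-1$) generated by $\pi^{(k)}$, and $E^{\mathrm{off},\pi^{(k)}}_{t:T-1}$ is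 the average of $G^{\mathrm{PDIS}}_k$ over $n$ independent trajectory segments generated by $\hat\mu$; conditioning on $S_t=s$ means all these segments start in $s$ at time $t$. *)

theory Defs
  imports "HOL-Probability.Probability"
begin

record ('s, 'a) mdp =
  transition :: "'s \<Rightarrow> 'a \<Rightarrow> 's pmf"
  reward :: "'s \<Rightarrow> 'a \<Rightarrow> real"
  horizon :: nat

text \<open>A policy is given by \<open>\<pi> t s\<close>, the law of the action at time \<open>t\<close> in state \<open>s\<close>; only the
  times \<open>t < horizon M\<close> are ever used.\<close>

type_synonym ('s, 'a) policy = "nat \<Rightarrow> 's \<Rightarrow> 'a pmf"

text \<open>Position \<open>j\<close> of a segment that starts at time \<open>t\<close> is the triple (state at time \<open>t + j\<close>,
  action at time \<open>t + j\<close>, reward at time \<open>t + j + 1\<close>).\<close>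

type_synonym ('s, 'a) segment = "('s \<times> 'a \<times> real) list"

primrec rollout ::
  "('s, 'a) mdp \<Rightarrow> ('s, 'a) policy \<Rightarrow> nat \<Rightarrow> nat \<Rightarrow> 's \<Rightarrow> ('s, 'a) segment pmf"
where
  "rollout M \<mu> 0 t s = return_pmf []"
| "rollout M \<mu> (Suc m) t s =
     bind_pmf (\<mu> t s) (\<lambda>a.
     bind_pmf (transition M s a) (\<lambda>s'.
     bind_pmf (rollout M \<mu> m (Suc t) s') (\<lambda>\<tau>.
     return_pmf ((s, a, reward M s a) # \<tau>))))"

text \<open>Law of the segment from time \<open>t\<close> to time \<open>horizon M - 1\<close> generated by \<open>\<mu>\<close>, given that the
  state at time \<open>t\<close> is \<open>s\<close>; then also given that the action at time \<open>t\<close> is \<open>a\<close>.\<close>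

definition segment_pmf ::
  "('s, 'a) mdp \<Rightarrow> ('s, 'a) policy \<Rightarrow> nat \<Rightarrow> 's \<Rightarrow> ('s, 'a) segment pmf"
where
  "segment_pmf M \<mu> t s = rollout M \<mu> (horizon M - t) t s"

definition segment_action_pmf ::
  "('s, 'a) mdp \<Rightarrow> ('s, 'a) policy \<Rightarrow> nat \<Rightarrow> 's \<Rightarrow> 'a \<Rightarrow> ('s, 'a) segment pmf"
where
  "segment_action_pmf M \<mu> t s a =
     bind_pmf (transition M s a) (\<lambda>s'.
     bind_pmf (segment_pmf M \<mu> (Suc t) s') (\<lambda>\<tau>.
     return_pmf ((s, a, reward M s a) # \<tau>)))"

definition seg_state :: "nat \<Rightarrow> ('s, 'a) segment \<Rightarrow> nat \<Rightarrow> 's" where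
  "seg_state t \<tau> i = fst (\<tau> ! (i - t))"

definition seg_action :: "nat \<Rightarrow> ('s, 'a) segment \<Rightarrow> nat \<Rightarrow> 'a" where
  "seg_action t \<tau> i = fst (snd (\<tau> ! (i - t)))"

text \<open>The reward at time \<open>i\<close>, which is produced by the action at time \<open>i - 1\<close>.\<close>

definition seg_reward :: "nat \<Rightarrow> ('s, 'a) segment \<Rightarrow> nat \<Rightarrow> real" where
  "seg_reward t \<tau> i = snd (snd (\<tau> ! (i - 1 - t)))"

definition state_value :: "('s, 'a) mdp \<Rightarrow> ('s, 'a) policy \<Rightarrow> nat \<Rightarrow> 's \<Rightarrow> real" where
  "state_value M \<pi> t s =
     measure_pmf.expectation (segment_pmf M \<pi> t s) (\<lambda>\<tau>. \<Sum>i = Suc t..horizon M. seg_reward t \<tau> i)"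

definition action_value :: "('s, 'a) mdp \<Rightarrow> ('s, 'a) policy \<Rightarrow> nat \<Rightarrow> 's \<Rightarrow> 'a \<Rightarrow> real" where
  "action_value M \<pi> t s a =
     measure_pmf.expectation (segment_action_pmf M \<pi> t s a)
       (\<lambda>\<tau>. \<Sum>i = Suc t..horizon M. seg_reward t \<tau> i)"

text \<open>If \<open>\<mu>\<close> does not take the action \<open>a\<close> in state \<open>s\<close> at time \<open>j\<close>, the ratio is \<open>0\<close> by the
  convention on division; such an action has probability zero under \<open>\<mu>\<close>.\<close>

definition is_ratio :: "('s, 'a) policy \<Rightarrow> ('s, 'a) policy \<Rightarrow> nat \<Rightarrow> 's \<Rightarrow> 'a \<Rightarrow> real" where
  "is_ratio \<pi> \<mu> j s a = pmf (\<pi> j s) a / pmf (\<mu> j s) a"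

definition PDIS ::
  "('s, 'a) mdp \<Rightarrow> ('s, 'a) policy \<Rightarrow> ('s, 'a) policy \<Rightarrow> nat \<Rightarrow> ('s, 'a) segment \<Rightarrow> real"
where
  "PDIS M \<pi> \<mu> t \<tau> =
     (\<Sum>i = t..<horizon M.
        (\<Prod>j = t..i. is_ratio \<pi> \<mu> j (seg_state t \<tau> j) (seg_action t \<tau> j)) * seg_reward t \<tau> (Suc i))"

definition nu :: "('s, 'a) mdp \<Rightarrow> ('s, 'a) policy \<Rightarrow> nat \<Rightarrow> 's \<Rightarrow> 'a \<Rightarrow> real" where
  "nu M \<pi> t s a =
     (if Suc t < horizon M
      then measure_pmf.variance (transition M s a) (state_value M \<pi> (Suc t))
      else 0)"

definition q_hat :: "('s::finite, 'a) mdp \<Rightarrow> ('s, 'a) policy \<Rightarrow> nat \<Rightarrow> 's \<Rightarrow> 'a \<Rightarrow> real" where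
  "q_hat M \<pi> t s a =
     (if Suc t < horizon M
      then (action_value M \<pi> t s a)\<^sup>2 + nu M \<pi> t s a
           + (\<Sum>s'\<in>UNIV. pmf (transition M s a) s' *
                measure_pmf.variance (segment_pmf M \<pi> (Suc t) s') (PDIS M \<pi> \<pi> (Suc t)))
      else (action_value M \<pi> t s a)\<^sup>2)"

definition proportional_pmf :: "('a::finite \<Rightarrow> real) \<Rightarrow> 'a pmf" where
  "proportional_pmf f =
     embed_pmf (\<lambda>a. if \<forall>b. f b = 0 then 1 / real CARD('a) else f a / (\<Sum>b\<in>UNIV. f b))"

lemma pmf_proportional_pmf:
  fixes f :: "'a::finite \<Rightarrow> real"
  assumes nonneg: "\<And>a. 0 \<le> f a"
  shows "pmf (proportional_pmf f) a =
           (if \<forall>b. f b = 0 then 1 / real CARD('a) else f a / (\<Sum>b\<in>UNIV. f b))"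
proof -
  define g where "g a = (if \<forall>b. f b = 0 then 1 / real CARD('a) else f a / (\<Sum>b\<in>UNIV. f b))" for a
  have g_nonneg: "0 \<le> g a" for a
    unfolding g_def by (auto intro!: divide_nonneg_nonneg sum_nonneg nonneg)
  have "(\<Sum>a\<in>UNIV. g a) = 1"
  proof (cases "\<forall>b. f b = 0")
    case False
    then have "(\<Sum>b\<in>UNIV. f b) \<noteq> 0"
      using nonneg by (simp add: sum_nonneg_eq_0_iff)
    moreover have "g a = f a / (\<Sum>b\<in>UNIV. f b)" for a
      unfolding g_def using False by (simp only: if_False)
    ultimately show ?thesis
      by (simp flip: sum_divide_distrib)
  qed (simp add: g_def)
  then have "(\<integral>\<^sup>+a. ennreal (g a) \<partial>count_space UNIV) = 1"
    by (simp add: nn_integral_count_space_finite sum_ennreal g_nonneg)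
  then have "pmf (embed_pmf g) a = g a"
    by (intro pmf_embed_pmf g_nonneg)
  then show ?thesis
    unfolding proportional_pmf_def g_def .
qed

definition weight :: "('s::finite, 'a) mdp \<Rightarrow> ('s, 'a) policy \<Rightarrow> nat \<Rightarrow> 's \<Rightarrow> 'a \<Rightarrow> real" where
  "weight M \<pi> t s a = (pmf (\<pi> t s) a)\<^sup>2 * q_hat M \<pi> t s a"

text \<open>In the following, \<open>\<pi> k\<close> for \<open>k \<in> {1..K}\<close> are the target policies.\<close>

definition mu_hat ::
  "('s::finite, 'a::finite) mdp \<Rightarrow> nat \<Rightarrow> (nat \<Rightarrow> ('s, 'a) policy) \<Rightarrow> ('s, 'a) policy"
where
  "mu_hat M K \<pi> t s =
     proportional_pmf (\<lambda>a. sqrt (\<Sum>k = 1..K. (pmf (\<pi> k t s) a)\<^sup>2 * q_hat M (\<pi> k) t s a))"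

definition mean_weight ::
  "('s::finite, 'a) mdp \<Rightarrow> nat \<Rightarrow> (nat \<Rightarrow> ('s, 'a) policy) \<Rightarrow> nat \<Rightarrow> 's \<Rightarrow> 'a \<Rightarrow> real"
where
  "mean_weight M K \<pi> t s a = 1 / real K * (\<Sum>j = 1..K. weight M (\<pi> j) t s a)"

definition eta ::
  "('s::finite, 'a) mdp \<Rightarrow> nat \<Rightarrow> (nat \<Rightarrow> ('s, 'a) policy) \<Rightarrow> nat \<Rightarrow> nat \<Rightarrow> 's \<Rightarrow> 'a \<Rightarrow> real"
where
  "eta M K \<pi> k t s a = weight M (\<pi> k) t s a / mean_weight M K \<pi> t s a"

text \<open>The minimum and the maximum of \<open>eta\<close> range over the \<open>(k, s, a)\<close> for which \<open>eta\<close> is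
  well-defined, that is, not of the form \<open>0 / 0\<close>. (A value \<open>0\<close> assigned to \<open>0 / 0\<close> would wrongly
  force the minimum to be \<open>0\<close>.)\<close>

definition eta_values ::
  "('s::finite, 'a) mdp \<Rightarrow> nat \<Rightarrow> (nat \<Rightarrow> ('s, 'a) policy) \<Rightarrow> nat \<Rightarrow> real set"
where
  "eta_values M K \<pi> t =
     {eta M K \<pi> k t s a | k s a. k \<in> {1..K} \<and> mean_weight M K \<pi> t s a \<noteq> 0}"

definition eta_min ::
  "('s::finite, 'a) mdp \<Rightarrow> nat \<Rightarrow> (nat \<Rightarrow> ('s, 'a) policy) \<Rightarrow> nat \<Rightarrow> real"
where
  "eta_min M K \<pi> t = Min (eta_values M K \<pi> t)"

definition eta_max ::
  "('s::finite, 'a) mdp \<Rightarrow> nat \<Rightarrow> (nat \<Rightarrow> ('s, 'a) policy) \<Rightarrow> nat \<Rightarrow> real"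
where
  "eta_max M K \<pi> t = Max (eta_values M K \<pi> t)"

text \<open>The square root of \<open>eta_max / eta_min\<close>, which is infinite (not \<open>0\<close>, as division by zero
  on the reals would have it) if \<open>eta_min = 0\<close>. If no value of \<open>eta\<close> is well-defined at time
  \<open>t\<close>, then \<open>eta_min\<close> and \<open>eta_max\<close> are unspecified; this is harmless, because all weights at time
  \<open>t\<close> then vanish, so that this quantity only ever gets multiplied by \<open>0\<close>.\<close>

definition sqrt_eta_ratio ::
  "('s::finite, 'a) mdp \<Rightarrow> nat \<Rightarrow> (nat \<Rightarrow> ('s, 'a) policy) \<Rightarrow> nat \<Rightarrow> ereal"
where
  "sqrt_eta_ratio M K \<pi> t =
     (if eta_min M K \<pi> t = 0 then \<infinity> else ereal (sqrt (eta_max M K \<pi> t / eta_min M K \<pi> t)))"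

definition Delta ::
  "('s::finite, 'a::finite) mdp \<Rightarrow> nat \<Rightarrow> (nat \<Rightarrow> ('s, 'a) policy) \<Rightarrow> nat \<Rightarrow> nat \<Rightarrow> 's \<Rightarrow> real"
where
  "Delta M K \<pi> k t s =
     measure_pmf.expectation (mu_hat M K \<pi> t s)
       (\<lambda>a. (is_ratio (\<pi> k) (mu_hat M K \<pi>) t s a)\<^sup>2 * nu M (\<pi> k) t s a)
     + measure_pmf.variance (mu_hat M K \<pi> t s)
         (\<lambda>a. is_ratio (\<pi> k) (mu_hat M K \<pi>) t s a * action_value M (\<pi> k) t s a)"

text \<open>\<open>m\<close> independent segments generated by \<open>\<mu>\<close>, all of them starting in \<open>s\<close> at time \<open>t\<close>. The
  list \<open>[]\<close> is only the dummy value of \<open>Pi_pmf\<close> outside of the index set \<open>{..<m}\<close>.\<close>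

definition segments_pmf ::
  "('s, 'a) mdp \<Rightarrow> ('s, 'a) policy \<Rightarrow> nat \<Rightarrow> nat \<Rightarrow> 's \<Rightarrow> (nat \<Rightarrow> ('s, 'a) segment) pmf"
where
  "segments_pmf M \<mu> m t s = Pi_pmf {..<m} [] (\<lambda>_. segment_pmf M \<mu> t s)"

definition empirical_mean ::
  "('s, 'a) mdp \<Rightarrow> ('s, 'a) policy \<Rightarrow> ('s, 'a) policy \<Rightarrow> nat \<Rightarrow> nat \<Rightarrow>
    (nat \<Rightarrow> ('s, 'a) segment) \<Rightarrow> real"
where
  "empirical_mean M \<pi> \<mu> m t \<omega> = (\<Sum>i<m. PDIS M \<pi> \<mu> t (\<omega> i)) / real m"

end

theory Submission
  imports Defs
begin

text \<open>By the law of total variance, the variance of the PDIS estimator from time \<open>t\<close> is the variance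
  of \<open>\<rho> q\<close> over the first action plus the mean of \<open>\<rho>\<^sup>2 (\<nu> + V)\<close>, where \<open>V\<close> is the expected variance from
  time \<open>t + 1\<close>. With \<open>c = n\<^sub>k / n\<close>, backward induction gives \<open>c V\<^sub>o\<^sub>f\<^sub>f \<le> V\<^sub>o\<^sub>n\<close>: replacing \<open>c V\<^sub>o\<^sub>f\<^sub>f\<close> by
  \<open>V\<^sub>o\<^sub>n\<close> at time \<open>t + 1\<close> bounds \<open>c V\<^sub>o\<^sub>f\<^sub>f\<close> at time \<open>t\<close> by the mean of \<open>\<rho>\<^sup>2 q_hat\<close> minus
  \<open>(1 - c) \<Delta> + v\<^sup>2\<close>, while \<open>V\<^sub>o\<^sub>n\<close> is the mean of \<open>q_hat\<close> under \<open>\<pi>\<close> minus \<open>v\<^sup>2\<close>. Writing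
  \<open>w = \<eta> W / K\<close> with \<open>W\<close> the sum of the \<open>K\<close> weights, the mean of \<open>\<rho>\<^sup>2 q_hat\<close> under \<open>mu_hat\<close> is the sum
  of \<open>w / sqrt W\<close> times the sum of \<open>sqrt W\<close>, and bounding \<open>\<eta>\<close> from above in the first factor and from
  below in the second yields the left-hand side of the similarity condition.\<close>

section \<open>Moments of finitely supported distributions\<close>

lemma expectation_bind_pmf_finite:
  fixes g :: "'b \<Rightarrow> real"
  assumes "finite (set_pmf p)" "\<And>x. x \<in> set_pmf p \<Longrightarrow> finite (set_pmf (f x))"
  shows "measure_pmf.expectation (bind_pmf p f) g
           = measure_pmf.expectation p (\<lambda>x. measure_pmf.expectation (f x) g)"
proof -
  have "measure_pmf.expectation (bind_pmf p f) g
          = (\<Sum>x\<in>set_pmf p. pmf p x * measure_pmf.expectation (f x) g)"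
    using assms by (subst pmf_expectation_bind) auto
  also have "\<dots> = measure_pmf.expectation p (\<lambda>x. measure_pmf.expectation (f x) g)"
    using assms(1) by (subst integral_measure_pmf_real[of "set_pmf p"]) (auto simp: mult.commute)
  finally show ?thesis .
qed

lemma variance_pmf_finite:
  fixes g :: "'b \<Rightarrow> real"
  assumes "finite (set_pmf p)"
  shows "measure_pmf.variance p g
           = measure_pmf.expectation p (\<lambda>x. (g x)\<^sup>2) - (measure_pmf.expectation p g)\<^sup>2"
  using assms by (intro measure_pmf.variance_eq integrable_measure_pmf_finite)

text \<open>Law of total variance: once every variance is written as second moment minus squared
  mean, the mean square of the conditional expectation cancels.\<close>

lemma variance_bind_pmf_finite:
  fixes g :: "'b \<Rightarrow> real"
  assumes p: "finite (set_pmf p)" and f: "\<And>x. x \<in> set_pmf p \<Longrightarrow> finite (set_pmf (f x))"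
  shows "measure_pmf.variance (bind_pmf p f) g
           = measure_pmf.expectation p (\<lambda>x. measure_pmf.variance (f x) g)
             + measure_pmf.variance p (\<lambda>x. measure_pmf.expectation (f x) g)"
proof -
  have "measure_pmf.expectation p (\<lambda>x. measure_pmf.variance (f x) g)
      = measure_pmf.expectation p (\<lambda>x. measure_pmf.expectation (f x) (\<lambda>y. (g y)\<^sup>2)
          - (measure_pmf.expectation (f x) g)\<^sup>2)"
    using f by (intro integral_cong_AE AE_pmfI variance_pmf_finite) auto
  also have "\<dots> = measure_pmf.expectation (bind_pmf p f) (\<lambda>y. (g y)\<^sup>2)
      - measure_pmf.expectation p (\<lambda>x. (measure_pmf.expectation (f x) g)\<^sup>2)"
    using p f by (simp add: expectation_bind_pmf_finite integrable_measure_pmf_finite)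
  finally show ?thesis
    using p f by (subst (1 3) variance_pmf_finite) (simp_all add: expectation_bind_pmf_finite)
qed

text \<open>The shape \<open>c * (r + g x)\<close> is that of the recursion of \<open>PDIS\<close>
  along a segment, so that variances of one step can be computed by rewriting.\<close>

lemma variance_pmf_affine:
  fixes g :: "'b \<Rightarrow> real"
  assumes "finite (set_pmf p)"
  shows "measure_pmf.variance p (\<lambda>x. c * (r + g x)) = c\<^sup>2 * measure_pmf.variance p g"
proof -
  have "measure_pmf.expectation p (\<lambda>x. c * (r + g x)) = c * (r + measure_pmf.expectation p g)"
    using assms by (simp add: integrable_measure_pmf_finite)
  then have "(c * (r + g x) - measure_pmf.expectation p (\<lambda>x. c * (r + g x)))\<^sup>2
      = c\<^sup>2 * (g x - measure_pmf.expectation p g)\<^sup>2" for x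
    by (simp add: algebra_simps flip: power_mult_distrib)
  then show ?thesis by simp
qed

lemma expectation_pmf_UNIV:
  fixes f :: "'a::finite \<Rightarrow> real"
  shows "measure_pmf.expectation p f = (\<Sum>a\<in>UNIV. pmf p a * f a)"
  by (simp add: integral_measure_pmf_real[of UNIV] mult.commute)

lemma finite_set_Pi_pmf:
  assumes "finite A" "\<And>x. x \<in> A \<Longrightarrow> finite (set_pmf (p x))"
  shows "finite (set_pmf (Pi_pmf A dflt p))"
  using assms by (simp add: set_Pi_pmf finite_PiE_dflt)

text \<open>The last coordinate is drawn first and the law of total variance applied: the
  conditional variance given this draw is that of the other coordinates, and the conditional mean
  varies only through the new summand.\<close>

lemma variance_sum_Pi_pmf:
  fixes g :: "'b \<Rightarrow> real"
  assumes p: "finite (set_pmf p)"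
  shows "measure_pmf.variance (Pi_pmf {..<m} dflt (\<lambda>_. p)) (\<lambda>\<omega>. \<Sum>i<m. g (\<omega> i))
           = real m * measure_pmf.variance p g"
proof (induction m)
  case 0
  then show ?case by simp
next
  case (Suc m)
  let ?P = "Pi_pmf {..<m} dflt (\<lambda>_. p)" and ?S = "\<lambda>\<omega>. \<Sum>i<m. g (\<omega> i)"
  have P: "finite (set_pmf ?P)" using p by (intro finite_set_Pi_pmf) auto
  \<comment> \<open>The factor 1 gives the sum the shape required by
    \<open>variance_pmf_affine\<close>.\<close>
  have sum_upd: "(\<Sum>i<Suc m. g (fun_upd \<omega> m y i)) = 1 * (g y + ?S \<omega>)" for \<omega> y
    by simp
  have "Pi_pmf {..<Suc m} dflt (\<lambda>_. p)
      = bind_pmf p (\<lambda>y. map_pmf (\<lambda>\<omega>. fun_upd \<omega> m y) ?P)"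
    unfolding lessThan_Suc by (subst Pi_pmf_insert') (auto simp: map_pmf_def)
  then have "measure_pmf.variance (Pi_pmf {..<Suc m} dflt (\<lambda>_. p)) (\<lambda>\<omega>. \<Sum>i<Suc m. g (\<omega> i))
     = measure_pmf.expectation p
         (\<lambda>y. measure_pmf.variance (map_pmf (\<lambda>\<omega>. fun_upd \<omega> m y) ?P) (\<lambda>\<omega>. \<Sum>i<Suc m. g (\<omega> i)))
       + measure_pmf.variance p
         (\<lambda>y. measure_pmf.expectation (map_pmf (\<lambda>\<omega>. fun_upd \<omega> m y) ?P) (\<lambda>\<omega>. \<Sum>i<Suc m. g (\<omega> i)))"
    using p P by (simp only:) (subst variance_bind_pmf_finite, auto)
  also have "\<dots> = measure_pmf.variance ?P ?S
       + measure_pmf.variance p (\<lambda>y. 1 * (measure_pmf.expectation ?P ?S + g y))"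
    unfolding integral_map_pmf sum_upd variance_pmf_affine[OF P]
    using P by (simp add: integrable_measure_pmf_finite add.commute)
  also have "\<dots> = real (Suc m) * measure_pmf.variance p g"
    unfolding variance_pmf_affine[OF p] Suc.IH by (simp add: algebra_simps)
  finally show ?case .
qed

section \<open>Finiteness of segment laws and the variance of empirical means\<close>

lemma finite_set_rollout:
  fixes M :: "('s::finite, 'a::finite) mdp"
  shows "finite (set_pmf (rollout M \<mu> m t s))"
  by (induction m arbitrary: t s) auto

lemma finite_set_segment_pmf [simp]:
  fixes M :: "('s::finite, 'a::finite) mdp"
  shows "finite (set_pmf (segment_pmf M \<mu> t s))"
  by (simp add: segment_pmf_def finite_set_rollout)

lemma finite_set_segment_action_pmf [simp]:
  fixes M :: "('s::finite, 'a::finite) mdp"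
  shows "finite (set_pmf (segment_action_pmf M \<mu> t s a))"
  by (simp add: segment_action_pmf_def)

text \<open>Reduces the comparison of averages to that of single segments. For \<open>m = 0\<close>
  both sides are 0 by the convention on division.\<close>

lemma variance_empirical_mean:
  fixes M :: "('s::finite, 'a::finite) mdp"
  shows "measure_pmf.variance (segments_pmf M \<mu> m t s) (empirical_mean M \<pi> \<mu> m t)
           = measure_pmf.variance (segment_pmf M \<mu> t s) (PDIS M \<pi> \<mu> t) / real m"
proof -
  let ?P = "segments_pmf M \<mu> m t s"
  have P: "finite (set_pmf ?P)"
    unfolding segments_pmf_def by (intro finite_set_Pi_pmf) auto
  have *: "empirical_mean M \<pi> \<mu> m t = (\<lambda>\<omega>. (1 / real m) * (0 + (\<Sum>i<m. PDIS M \<pi> \<mu> t (\<omega> i))))"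
    by (auto simp: empirical_mean_def)
  show ?thesis
    unfolding * variance_pmf_affine[OF P]
    unfolding segments_pmf_def
    by (subst variance_sum_Pi_pmf) (auto simp: power2_eq_square)
qed

section \<open>One-step recursions for segments, \<open>PDIS\<close>, and value functions\<close>

lemma segment_pmf_Suc:
  assumes "t < horizon M"
  shows "segment_pmf M \<mu> t s = bind_pmf (\<mu> t s) (segment_action_pmf M \<mu> t s)"
proof -
  have "horizon M - t = Suc (horizon M - Suc t)" using assms by simp
  then show ?thesis by (simp add: segment_pmf_def segment_action_pmf_def[abs_def])
qed

lemma segment_action_pmf_eq_map:
  "segment_action_pmf M \<mu> t s a =
     bind_pmf (transition M s a)
       (\<lambda>s'. map_pmf (\<lambda>\<tau>. (s, a, reward M s a) # \<tau>) (segment_pmf M \<mu> (Suc t) s'))"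
  by (simp add: segment_action_pmf_def map_pmf_def)

lemma sum_seg_reward_Cons:
  assumes "t < h"
  shows "(\<Sum>i = Suc t..h. seg_reward t ((s, a, r) # \<tau>) i)
           = r + (\<Sum>i = Suc (Suc t)..h. seg_reward (Suc t) \<tau> i)"
proof -
  have "seg_reward t ((s, a, r) # \<tau>) i = seg_reward (Suc t) \<tau> i" if "i \<in> {Suc (Suc t)..h}" for i
  proof -
    have "i - 1 - t = Suc (i - 1 - Suc t)" using that by auto
    then show ?thesis by (simp only: seg_reward_def nth_Cons_Suc)
  qed
  then show ?thesis
    using assms by (subst sum.atLeast_Suc_atMost) (auto simp: seg_reward_def intro!: sum.cong)
qed

text \<open>Each product of ratios contains the factor for time \<open>t\<close>, which can be
  pulled out of the whole sum; the later factors and rewards are those of the tail, read with its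
  start shifted to \<open>Suc t\<close>.\<close>

lemma PDIS_Cons:
  assumes "t < horizon M"
  shows "PDIS M \<pi> \<mu> t ((s, a, r) # \<tau>) = is_ratio \<pi> \<mu> t s a * (r + PDIS M \<pi> \<mu> (Suc t) \<tau>)"
proof -
  let ?\<tau> = "(s, a, r) # \<tau>"
  have shift: "i - t = Suc (i - Suc t)" if "i \<ge> Suc t" for i
    using that by auto
  have state: "seg_state t ?\<tau> i = seg_state (Suc t) \<tau> i"
    and act: "seg_action t ?\<tau> i = seg_action (Suc t) \<tau> i"
    and rew: "seg_reward t ?\<tau> (Suc i) = seg_reward (Suc t) \<tau> (Suc i)" if "i \<ge> Suc t" for i
    using shift[OF that] by (simp_all add: seg_state_def seg_action_def seg_reward_def)
  have "(\<Prod>j = t..i. is_ratio \<pi> \<mu> j (seg_state t ?\<tau> j) (seg_action t ?\<tau> j))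
      = is_ratio \<pi> \<mu> t s a *
        (\<Prod>j = Suc t..i. is_ratio \<pi> \<mu> j (seg_state (Suc t) \<tau> j) (seg_action (Suc t) \<tau> j))"
    if "i \<ge> t" for i
  proof -
    have "(\<Prod>j = Suc t..i. is_ratio \<pi> \<mu> j (seg_state t ?\<tau> j) (seg_action t ?\<tau> j))
        = (\<Prod>j = Suc t..i. is_ratio \<pi> \<mu> j (seg_state (Suc t) \<tau> j) (seg_action (Suc t) \<tau> j))"
      by (intro prod.cong refl) (simp add: state act)
    then show ?thesis
      using that by (subst prod.atLeast_Suc_atMost) (auto simp: seg_state_def seg_action_def)
  qed
  then have "PDIS M \<pi> \<mu> t ?\<tau> = (\<Sum>i = t..<horizon M. is_ratio \<pi> \<mu> t s a *
        ((\<Prod>j = Suc t..i. is_ratio \<pi> \<mu> j (seg_state (Suc t) \<tau> j) (seg_action (Suc t) \<tau> j))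
          * seg_reward t ?\<tau> (Suc i)))"
    unfolding PDIS_def by (intro sum.cong refl) (simp add: mult.assoc)
  also have "\<dots> = is_ratio \<pi> \<mu> t s a * (r + (\<Sum>i = Suc t..<horizon M.
        (\<Prod>j = Suc t..i. is_ratio \<pi> \<mu> j (seg_state (Suc t) \<tau> j) (seg_action (Suc t) \<tau> j))
          * seg_reward t ?\<tau> (Suc i)))"
    using assms by (simp add: sum.atLeast_Suc_lessThan seg_reward_def flip: sum_distrib_left)
  finally show ?thesis
    by (simp add: PDIS_def rew)
qed

lemma state_value_horizon: "state_value M \<pi> (horizon M) = (\<lambda>_. 0)"
  by (simp add: state_value_def fun_eq_iff)

lemma action_value_step:
  fixes M :: "('s::finite, 'a::finite) mdp"
  assumes "t < horizon M"
  shows "action_value M \<pi> t s a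
           = reward M s a + measure_pmf.expectation (transition M s a) (state_value M \<pi> (Suc t))"
  unfolding action_value_def state_value_def segment_action_pmf_eq_map
  by (subst expectation_bind_pmf_finite)
     (auto simp: sum_seg_reward_Cons[OF assms] integrable_measure_pmf_finite)

lemma state_value_step:
  fixes M :: "('s::finite, 'a::finite) mdp"
  assumes "t < horizon M"
  shows "state_value M \<pi> t s = measure_pmf.expectation (\<pi> t s) (action_value M \<pi> t s)"
  unfolding action_value_def state_value_def segment_pmf_Suc[OF assms]
  by (subst expectation_bind_pmf_finite) auto

text \<open>At the last decision time the next state value is constantly 0, so the separate case in
  the definition agrees with the variance and the recursion needs no special last step.\<close>

lemma nu_eq_variance:
  assumes "t < horizon M"
  shows "nu M \<pi> t s a = measure_pmf.variance (transition M s a) (state_value M \<pi> (Suc t))"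
proof (cases "Suc t < horizon M")
  case False
  then have "Suc t = horizon M" using assms by simp
  then show ?thesis by (simp add: nu_def state_value_horizon)
qed (simp add: nu_def)

section \<open>Unbiasedness and variance recursion of the estimator\<close>

definition PDIS_variance ::
  "('s, 'a) mdp \<Rightarrow> ('s, 'a) policy \<Rightarrow> ('s, 'a) policy \<Rightarrow> nat \<Rightarrow> 's \<Rightarrow> real"
where
  "PDIS_variance M \<pi> \<mu> t s = measure_pmf.variance (segment_pmf M \<mu> t s) (PDIS M \<pi> \<mu> t)"

lemma PDIS_variance_nonneg: "0 \<le> PDIS_variance M \<pi> \<mu> t s"
  unfolding PDIS_variance_def by (rule measure_pmf.variance_positive)

lemma PDIS_variance_horizon: "horizon M \<le> t \<Longrightarrow> PDIS_variance M \<pi> \<mu> t = (\<lambda>_. 0)"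
  by (simp add: PDIS_variance_def PDIS_def[abs_def] fun_eq_iff)

text \<open>From the last decision time on, \<open>nu\<close> and the remaining variance are both 0,
  which removes the case distinction.\<close>

lemma q_hat_eq:
  fixes M :: "('s::finite, 'a::finite) mdp"
  shows "q_hat M \<pi> t s a = (action_value M \<pi> t s a)\<^sup>2 + nu M \<pi> t s a
     + measure_pmf.expectation (transition M s a) (PDIS_variance M \<pi> \<pi> (Suc t))"
  by (auto simp: q_hat_def nu_def PDIS_variance_horizon expectation_pmf_UNIV)
     (simp add: PDIS_variance_def)

lemma nu_nonneg: "0 \<le> nu M \<pi> t s a"
  unfolding nu_def using measure_pmf.variance_positive by simp

text \<open>Serves to show that an action of weight 0 contributes nothing to the mean, which is what
  \<open>covers\<close> asks of \<open>mu_hat\<close>.\<close>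

lemma q_hat_ge_square:
  fixes M :: "('s::finite, 'a::finite) mdp"
  shows "(action_value M \<pi> t s a)\<^sup>2 \<le> q_hat M \<pi> t s a"
  unfolding q_hat_eq by (simp add: nu_nonneg PDIS_variance_nonneg)

lemma q_hat_nonneg:
  fixes M :: "('s::finite, 'a::finite) mdp"
  shows "0 \<le> q_hat M \<pi> t s a"
  using q_hat_ge_square order_trans zero_le_power2 by blast

text \<open>Weaker than absolute continuity, because \<open>mu_hat\<close> misses the actions of weight \<open>0\<close>, which
  \<open>\<pi>\<close> may take; it still suffices for unbiasedness.\<close>

definition covers ::
  "('s, 'a) mdp \<Rightarrow> ('s, 'a) policy \<Rightarrow> ('s, 'a) policy \<Rightarrow> bool"
where
  "covers M \<mu> \<pi> \<longleftrightarrow>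
     (\<forall>t<horizon M. \<forall>s a. pmf (\<mu> t s) a = 0 \<longrightarrow> pmf (\<pi> t s) a * action_value M \<pi> t s a = 0)"

lemma covers_refl: "covers M \<pi> \<pi>"
  by (simp add: covers_def)

lemma expectation_ratio_action_value:
  fixes M :: "('s::finite, 'a::finite) mdp"
  assumes "covers M \<mu> \<pi>" "t < horizon M"
  shows "measure_pmf.expectation (\<mu> t s) (\<lambda>a. is_ratio \<pi> \<mu> t s a * action_value M \<pi> t s a)
           = state_value M \<pi> t s"
  unfolding state_value_step[OF assms(2)] expectation_pmf_UNIV
  using assms by (intro sum.cong refl) (auto simp: is_ratio_def covers_def)

lemma expectation_PDIS_action:
  fixes M :: "('s::finite, 'a::finite) mdp"
  assumes "t < horizon M"
  shows "measure_pmf.expectation (segment_action_pmf M \<mu> t s a) (PDIS M \<pi> \<mu> t)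
     = is_ratio \<pi> \<mu> t s a * (reward M s a + measure_pmf.expectation (transition M s a)
         (\<lambda>s'. measure_pmf.expectation (segment_pmf M \<mu> (Suc t) s') (PDIS M \<pi> \<mu> (Suc t))))"
  unfolding segment_action_pmf_eq_map
  by (subst expectation_bind_pmf_finite)
     (auto simp: PDIS_Cons[OF assms] integrable_measure_pmf_finite)

text \<open>Backward induction: given the first action, the mean is the ratio times the action
  value, and averaging over \<open>\<mu>\<close> cancels the ratio wherever \<open>\<mu>\<close> is
  positive; \<open>covers\<close> handles the other actions.\<close>

lemma expectation_PDIS:
  fixes M :: "('s::finite, 'a::finite) mdp"
  assumes cov: "covers M \<mu> \<pi>" and "t \<le> horizon M"
  shows "measure_pmf.expectation (segment_pmf M \<mu> t s) (PDIS M \<pi> \<mu> t) = state_value M \<pi> t s"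
  using assms(2)
proof (induction arbitrary: s rule: inc_induct)
  case base
  show ?case by (simp add: PDIS_def state_value_horizon)
next
  case (step t)
  have "measure_pmf.expectation (segment_pmf M \<mu> t s) (PDIS M \<pi> \<mu> t)
      = measure_pmf.expectation (\<mu> t s) (\<lambda>a. is_ratio \<pi> \<mu> t s a * action_value M \<pi> t s a)"
    unfolding segment_pmf_Suc[OF step.hyps(2)]
    by (subst expectation_bind_pmf_finite)
       (auto simp: expectation_PDIS_action[OF step.hyps(2)] action_value_step[OF step.hyps(2)] step.IH)
  then show ?case
    using expectation_ratio_action_value[OF cov step.hyps(2)] by simp
qed

text \<open>The law of total variance is applied twice, over the first action and over the next
  state; unbiasedness turns the conditional means into action values and state values.\<close>

lemma PDIS_variance_step:
  fixes M :: "('s::finite, 'a::finite) mdp"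
  assumes cov: "covers M \<mu> \<pi>" and t: "t < horizon M"
  shows "PDIS_variance M \<pi> \<mu> t s
     = measure_pmf.variance (\<mu> t s) (\<lambda>a. is_ratio \<pi> \<mu> t s a * action_value M \<pi> t s a)
       + measure_pmf.expectation (\<mu> t s) (\<lambda>a. (is_ratio \<pi> \<mu> t s a)\<^sup>2 *
           (nu M \<pi> t s a + measure_pmf.expectation (transition M s a) (PDIS_variance M \<pi> \<mu> (Suc t))))"
proof -
  have mean: "measure_pmf.expectation (segment_pmf M \<mu> (Suc t) s') (PDIS M \<pi> \<mu> (Suc t))
      = state_value M \<pi> (Suc t) s'" for s'
    using t by (intro expectation_PDIS[OF cov]) simp
  have action_mean: "measure_pmf.expectation (segment_action_pmf M \<mu> t s a) (PDIS M \<pi> \<mu> t)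
      = is_ratio \<pi> \<mu> t s a * action_value M \<pi> t s a" for a
    by (simp add: expectation_PDIS_action[OF t] action_value_step[OF t] mean)
  have action_variance: "measure_pmf.variance (segment_action_pmf M \<mu> t s a) (PDIS M \<pi> \<mu> t)
      = (is_ratio \<pi> \<mu> t s a)\<^sup>2 * (nu M \<pi> t s a
          + measure_pmf.expectation (transition M s a) (PDIS_variance M \<pi> \<mu> (Suc t)))" for a
  proof -
    let ?f = "\<lambda>s'. map_pmf (\<lambda>\<tau>. (s, a, reward M s a) # \<tau>) (segment_pmf M \<mu> (Suc t) s')"
    have "measure_pmf.variance (?f s') (PDIS M \<pi> \<mu> t)
        = (is_ratio \<pi> \<mu> t s a)\<^sup>2 * PDIS_variance M \<pi> \<mu> (Suc t) s'" for s'
      unfolding integral_map_pmf PDIS_Cons[OF t] variance_pmf_affine[OF finite_set_segment_pmf]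
      by (simp add: PDIS_variance_def)
    moreover have "measure_pmf.expectation (?f s') (PDIS M \<pi> \<mu> t)
        = is_ratio \<pi> \<mu> t s a * (reward M s a + state_value M \<pi> (Suc t) s')" for s'
      unfolding integral_map_pmf PDIS_Cons[OF t]
      by (simp add: integrable_measure_pmf_finite mean)
    ultimately have "measure_pmf.variance (segment_action_pmf M \<mu> t s a) (PDIS M \<pi> \<mu> t)
        = measure_pmf.expectation (transition M s a)
            (\<lambda>s'. (is_ratio \<pi> \<mu> t s a)\<^sup>2 * PDIS_variance M \<pi> \<mu> (Suc t) s')
          + measure_pmf.variance (transition M s a)
            (\<lambda>s'. is_ratio \<pi> \<mu> t s a * (reward M s a + state_value M \<pi> (Suc t) s'))"
      unfolding segment_action_pmf_eq_map
      by (subst variance_bind_pmf_finite) (simp_all del: integral_map_pmf)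
    also have "measure_pmf.variance (transition M s a)
            (\<lambda>s'. is_ratio \<pi> \<mu> t s a * (reward M s a + state_value M \<pi> (Suc t) s'))
        = (is_ratio \<pi> \<mu> t s a)\<^sup>2 * nu M \<pi> t s a"
      unfolding nu_eq_variance[OF t] by (rule variance_pmf_affine) simp
    finally show ?thesis by (simp add: algebra_simps)
  qed
  have "PDIS_variance M \<pi> \<mu> t s = measure_pmf.expectation (\<mu> t s)
          (\<lambda>a. measure_pmf.variance (segment_action_pmf M \<mu> t s a) (PDIS M \<pi> \<mu> t))
        + measure_pmf.variance (\<mu> t s)
          (\<lambda>a. measure_pmf.expectation (segment_action_pmf M \<mu> t s a) (PDIS M \<pi> \<mu> t))"
    unfolding PDIS_variance_def[of M \<pi> \<mu> t] segment_pmf_Suc[OF t]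
    by (intro variance_bind_pmf_finite) simp_all
  then show ?thesis
    unfolding action_variance unfolding action_mean by simp
qed

text \<open>On the support of \<open>\<pi>\<close> the ratio is 1, so the squared action value,
  \<open>nu\<close> and the later variance add up to \<open>q_hat\<close>.\<close>

lemma PDIS_variance_on_policy:
  fixes M :: "('s::finite, 'a::finite) mdp"
  assumes t: "t < horizon M"
  shows "PDIS_variance M \<pi> \<pi> t s
     = (\<Sum>a\<in>UNIV. pmf (\<pi> t s) a * q_hat M \<pi> t s a) - (state_value M \<pi> t s)\<^sup>2"
proof -
  let ?V = "\<lambda>a. measure_pmf.expectation (transition M s a) (PDIS_variance M \<pi> \<pi> (Suc t))"
  have "PDIS_variance M \<pi> \<pi> t s
     = (\<Sum>a\<in>UNIV. pmf (\<pi> t s) a * (is_ratio \<pi> \<pi> t s a * action_value M \<pi> t s a)\<^sup>2)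
       - (state_value M \<pi> t s)\<^sup>2
       + (\<Sum>a\<in>UNIV. pmf (\<pi> t s) a * ((is_ratio \<pi> \<pi> t s a)\<^sup>2 * (nu M \<pi> t s a + ?V a)))"
    unfolding PDIS_variance_step[OF covers_refl t]
    by (subst variance_pmf_finite)
       (auto simp: expectation_ratio_action_value[OF covers_refl t] expectation_pmf_UNIV[of "\<pi> t s"]
)
  also have "\<dots> = (\<Sum>a\<in>UNIV. pmf (\<pi> t s) a * (is_ratio \<pi> \<pi> t s a * action_value M \<pi> t s a)\<^sup>2
       + pmf (\<pi> t s) a * ((is_ratio \<pi> \<pi> t s a)\<^sup>2 * (nu M \<pi> t s a + ?V a))) - (state_value M \<pi> t s)\<^sup>2"
    by (simp add: sum.distrib)
  also have "(\<Sum>a\<in>UNIV. pmf (\<pi> t s) a * (is_ratio \<pi> \<pi> t s a * action_value M \<pi> t s a)\<^sup>2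
       + pmf (\<pi> t s) a * ((is_ratio \<pi> \<pi> t s a)\<^sup>2 * (nu M \<pi> t s a + ?V a)))
     = (\<Sum>a\<in>UNIV. pmf (\<pi> t s) a * q_hat M \<pi> t s a)"
    unfolding q_hat_eq by (intro sum.cong refl) (auto simp: is_ratio_def algebra_simps)
  finally show ?thesis .
qed


section \<open>The behavior policy \<open>mu_hat\<close> and the similarity condition\<close>

context
  fixes M :: "('s::finite, 'a::finite) mdp" and K :: nat and \<pi> :: "nat \<Rightarrow> ('s, 'a) policy"
begin

lemma weight_nonneg: "0 \<le> weight M (\<pi> k) t s a"
  by (simp add: weight_def q_hat_nonneg)

lemma sqrt_weight: "sqrt (weight M (\<pi> k) t s a) = pmf (\<pi> k t s) a * sqrt (q_hat M (\<pi> k) t s a)"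
  by (simp add: weight_def real_sqrt_mult)

lemma pmf_mu_hat:
  "pmf (mu_hat M K \<pi> t s) a =
     (if \<forall>b. (\<Sum>j = 1..K. weight M (\<pi> j) t s b) = 0 then 1 / real CARD('a)
      else sqrt (\<Sum>j = 1..K. weight M (\<pi> j) t s a)
        / (\<Sum>b\<in>UNIV. sqrt (\<Sum>j = 1..K. weight M (\<pi> j) t s b)))"
  unfolding mu_hat_def weight_def[symmetric]
  by (subst pmf_proportional_pmf) (auto intro!: sum_nonneg weight_nonneg)

lemma weight_eq_0:
  assumes "k \<in> {1..K}" "(\<Sum>j = 1..K. weight M (\<pi> j) t s a) = 0"
  shows "weight M (\<pi> k) t s a = 0"
  using assms by (subst (asm) sum_nonneg_eq_0_iff) (auto simp: weight_nonneg)

lemma weight_eq_0_if_pmf_mu_hat_eq_0: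
  assumes "k \<in> {1..K}" "pmf (mu_hat M K \<pi> t s) a = 0"
  shows "weight M (\<pi> k) t s a = 0"
proof -
  let ?W = "\<lambda>a. \<Sum>j = 1..K. weight M (\<pi> j) t s a"
  have W: "0 \<le> ?W b" for b by (intro sum_nonneg weight_nonneg)
  have "?W a = 0"
  proof (rule ccontr)
    assume a: "?W a \<noteq> 0"
    \<comment> \<open>The uniform branch has no action of probability 0, and a quotient with nonzero
      numerator is 0 only if its denominator is 0.\<close>
    then have "(\<Sum>b\<in>UNIV. sqrt (?W b)) = 0"
      using assms(2) by (auto simp: pmf_mu_hat split: if_splits)
    then have "sqrt (?W a) = 0"
      using W by (subst (asm) sum_nonneg_eq_0_iff) auto
    with a show False by simp
  qed
  then show ?thesis using weight_eq_0[OF assms(1)] by simp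
qed

lemma covers_mu_hat:
  assumes "k \<in> {1..K}"
  shows "covers M (mu_hat M K \<pi>) (\<pi> k)"
  unfolding covers_def
proof (intro allI impI)
  fix t s a
  assume "pmf (mu_hat M K \<pi> t s) a = 0"
  then have "weight M (\<pi> k) t s a = 0" by (rule weight_eq_0_if_pmf_mu_hat_eq_0[OF assms])
  then show "pmf (\<pi> k t s) a * action_value M (\<pi> k) t s a = 0"
    using q_hat_ge_square[of M "\<pi> k" t s a] by (auto simp: weight_def)
qed

lemma finite_eta_values: "finite (eta_values M K \<pi> t)"
proof (rule finite_subset)
  show "eta_values M K \<pi> t \<subseteq> (\<lambda>(k, s, a). eta M K \<pi> k t s a) ` ({1..K} \<times> UNIV \<times> UNIV)"
  proof
    fix x
    assume "x \<in> eta_values M K \<pi> t"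
    then obtain k s a where "k \<in> {1..K}" "x = eta M K \<pi> k t s a"
      by (auto simp: eta_values_def)
    then show "x \<in> (\<lambda>(k, s, a). eta M K \<pi> k t s a) ` ({1..K} \<times> UNIV \<times> UNIV)"
      by (intro image_eqI[of _ _ "(k, s, a)"]) auto
  qed
qed auto

lemma eta_nonneg: "0 \<le> eta M K \<pi> k t s a"
  unfolding eta_def mean_weight_def
  by (intro divide_nonneg_nonneg mult_nonneg_nonneg sum_nonneg weight_nonneg) auto

text \<open>The product form survives where \<open>eta\<close> is \<open>0 / 0\<close>, since there
  the weight vanishes as well.\<close>

lemma weight_eq_eta:
  assumes "k \<in> {1..K}"
  shows "real K * weight M (\<pi> k) t s a
           = eta M K \<pi> k t s a * (\<Sum>j = 1..K. weight M (\<pi> j) t s a)"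
proof (cases "(\<Sum>j = 1..K. weight M (\<pi> j) t s a) = 0")
  case True
  then show ?thesis using weight_eq_0[OF assms] by simp
next
  case False
  then show ?thesis using assms by (simp add: eta_def mean_weight_def)
qed

text \<open>The nonzero total weight puts this value into \<open>eta_values\<close>, so that the
  minimum is taken over a nonempty set and is itself a value of \<open>eta\<close>.\<close>

lemma eta_bounds:
  assumes k: "k \<in> {1..K}" and W: "(\<Sum>j = 1..K. weight M (\<pi> j) t s a) \<noteq> 0"
  shows "0 \<le> eta_min M K \<pi> t" "eta_min M K \<pi> t \<le> eta M K \<pi> k t s a"
    "eta M K \<pi> k t s a \<le> eta_max M K \<pi> t"
proof -
  have mem: "eta M K \<pi> k t s a \<in> eta_values M K \<pi> t"
    using k W by (auto simp: eta_values_def mean_weight_def)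
  then show "eta_min M K \<pi> t \<le> eta M K \<pi> k t s a" "eta M K \<pi> k t s a \<le> eta_max M K \<pi> t"
    unfolding eta_min_def eta_max_def by (auto simp: finite_eta_values)
  have "eta_min M K \<pi> t \<in> eta_values M K \<pi> t"
    unfolding eta_min_def using mem by (intro Min_in finite_eta_values) auto
  then show "0 \<le> eta_min M K \<pi> t"
    by (auto simp: eta_values_def eta_nonneg)
qed

lemma second_moment_mu_hat_le:
  assumes k: "k \<in> {1..K}" and pos: "eta_min M K \<pi> t \<noteq> 0"
  shows "(\<Sum>a\<in>UNIV. pmf (mu_hat M K \<pi> t s) a
            * ((is_ratio (\<pi> k) (mu_hat M K \<pi>) t s a)\<^sup>2 * q_hat M (\<pi> k) t s a))
         \<le> sqrt (eta_max M K \<pi> t / eta_min M K \<pi> t)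
            * (\<Sum>a\<in>UNIV. pmf (\<pi> k t s) a * sqrt (q_hat M (\<pi> k) t s a))\<^sup>2"
proof -
  let ?W = "\<lambda>a. \<Sum>j = 1..K. weight M (\<pi> j) t s a" and ?w = "weight M (\<pi> k) t s"
  let ?\<mu> = "pmf (mu_hat M K \<pi> t s)" and ?Z = "\<Sum>b\<in>UNIV. sqrt (\<Sum>j = 1..K. weight M (\<pi> j) t s b)"
  let ?lo = "eta_min M K \<pi> t" and ?hi = "eta_max M K \<pi> t"
  have W: "0 \<le> ?W a" for a by (intro sum_nonneg weight_nonneg)
  \<comment> \<open>Where \<open>mu_hat\<close> is 0, both sides are 0 by the convention on
    division.\<close>
  have moment: "?\<mu> a * ((is_ratio (\<pi> k) (mu_hat M K \<pi>) t s a)\<^sup>2 * q_hat M (\<pi> k) t s a) = ?w a / ?\<mu> a" for a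
    by (simp add: is_ratio_def weight_def power2_eq_square)
  show ?thesis
  \<comment> \<open>If all weights in \<open>s\<close> vanish, so do both sides. This case is
    separate because \<open>eta_values\<close> may then be empty, leaving the sign of
    \<open>eta_min\<close> unknown.\<close>
  proof (cases "\<forall>b. ?W b = 0")
    case True
    then have "?w b = 0" for b using weight_eq_0[OF k] by simp
    then show ?thesis unfolding moment sqrt_weight[symmetric] by simp
  next
    case False
    then obtain b where b: "?W b \<noteq> 0" by blast
    have lo: "0 < ?lo" using eta_bounds(1)[OF k b] pos by simp
    have hi: "0 < ?hi" using eta_bounds[OF k b] lo by linarith
    have K: "0 < real K" using k by simp
    have upper: "?w a / sqrt (?W a) \<le> sqrt (?hi / real K) * sqrt (?w a)" for a
    proof (cases "?W a = 0")
      case True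
      then show ?thesis using weight_eq_0[OF k] by simp
    next
      case nz: False
      have "real K * ?w a \<le> ?hi * ?W a"
        unfolding weight_eq_eta[OF k] using eta_bounds(3)[OF k nz] W by (intro mult_right_mono) auto
      then have "?w a \<le> ?hi / real K * ?W a" using K by (simp add: field_simps)
      then have "sqrt (?w a) \<le> sqrt (?hi / real K) * sqrt (?W a)"
        by (metis real_sqrt_le_mono real_sqrt_mult)
      then have "sqrt (?w a) / sqrt (?W a) \<le> sqrt (?hi / real K)"
        using nz W[of a] by (simp add: divide_le_eq)
      \<comment> \<open>One root of the weight is kept aside to complete \<open>?w a\<close> in the
        numerator.\<close>
      then have "sqrt (?w a) / sqrt (?W a) * sqrt (?w a) \<le> sqrt (?hi / real K) * sqrt (?w a)"
        by (intro mult_right_mono) (auto simp: weight_nonneg)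
      then show ?thesis using weight_nonneg[of k t s a] by simp
    qed
    have lower: "sqrt (?W a) \<le> sqrt (real K / ?lo) * sqrt (?w a)" for a
    proof (cases "?W a = 0")
      case True
      then show ?thesis using lo weight_nonneg by simp
    next
      case nz: False
      have "?lo * ?W a \<le> real K * ?w a"
        unfolding weight_eq_eta[OF k] using eta_bounds(2)[OF k nz] W by (intro mult_right_mono) auto
      then have "?W a \<le> real K / ?lo * ?w a" using lo by (simp add: field_simps)
      then show ?thesis by (metis real_sqrt_le_mono real_sqrt_mult)
    qed
    have "(\<Sum>a\<in>UNIV. ?w a / ?\<mu> a) = (\<Sum>a\<in>UNIV. ?w a / sqrt (?W a)) * ?Z"
      unfolding sum_distrib_right using False
      by (intro sum.cong refl) (simp only: pmf_mu_hat if_False, simp)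
    also have "\<dots> \<le> (\<Sum>a\<in>UNIV. sqrt (?hi / real K) * sqrt (?w a))
        * (\<Sum>a\<in>UNIV. sqrt (real K / ?lo) * sqrt (?w a))"
      using hi K W by (intro mult_mono sum_mono upper lower sum_nonneg mult_nonneg_nonneg) (auto simp: weight_nonneg)
    also have "\<dots> = (sqrt (?hi / real K) * sqrt (real K / ?lo)) * (\<Sum>a\<in>UNIV. sqrt (?w a))\<^sup>2"
      by (simp add: power2_eq_square flip: sum_distrib_left)
    \<comment> \<open>The factor \<open>K\<close> from the mean weight cancels between the two
      bounds.\<close>
    also have "sqrt (?hi / real K) * sqrt (real K / ?lo) = sqrt (?hi / ?lo)"
      using K by (simp flip: real_sqrt_mult)
    finally show ?thesis unfolding moment sqrt_weight .
  qed
qed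

text \<open>Returns from the extended reals. If the ratio is infinite, the finite right-hand side
  forces the sum of roots to be 0; then the second moment vanishes, and since
  \<open>\<infinity> * 0 = 0\<close> the condition still yields
  \<open>0 \<le> B + D\<close>.\<close>

lemma second_moment_mu_hat_le_similarity:
  assumes k: "k \<in> {1..K}"
    and sim: "sqrt_eta_ratio M K \<pi> t *
          ereal ((\<Sum>a\<in>UNIV. pmf (\<pi> k t s) a * sqrt (q_hat M (\<pi> k) t s a))\<^sup>2)
        - ereal D \<le> ereal B"
  shows "(\<Sum>a\<in>UNIV. pmf (mu_hat M K \<pi> t s) a
            * ((is_ratio (\<pi> k) (mu_hat M K \<pi>) t s a)\<^sup>2 * q_hat M (\<pi> k) t s a)) \<le> B + D"
proof (cases "eta_min M K \<pi> t = 0")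
  case False
  then show ?thesis
    using sim second_moment_mu_hat_le[OF k False, of s] by (simp add: sqrt_eta_ratio_def)
next
  case True
  let ?x = "\<Sum>a\<in>UNIV. pmf (\<pi> k t s) a * sqrt (q_hat M (\<pi> k) t s a)"
  have x: "?x = 0"
  proof (rule ccontr)
    assume "?x \<noteq> 0"
    then have "\<infinity> * ereal (?x\<^sup>2) = \<infinity>" by simp
    then show False using sim True by (simp add: sqrt_eta_ratio_def)
  qed
  then have "sqrt (weight M (\<pi> k) t s a) = 0" for a
    by (subst (asm) sum_nonneg_eq_0_iff) (auto simp: q_hat_nonneg weight_def)
  then have "pmf (\<pi> k t s) a = 0 \<or> q_hat M (\<pi> k) t s a = 0" for a
    by (simp add: weight_def)
  then have "(\<Sum>a\<in>UNIV. pmf (mu_hat M K \<pi> t s) a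
            * ((is_ratio (\<pi> k) (mu_hat M K \<pi>) t s a)\<^sup>2 * q_hat M (\<pi> k) t s a)) = 0"
    by (intro sum.neutral) (auto simp: is_ratio_def)
  moreover have "0 \<le> B + D"
    using sim True x by (simp add: sqrt_eta_ratio_def)
  ultimately show ?thesis by linarith
qed

lemma PDIS_variance_mu_hat_le:
  assumes k: "k \<in> {1..K}"
    and sim: "\<And>t s. t < horizon M \<Longrightarrow> sqrt_eta_ratio M K \<pi> t *
          ereal ((\<Sum>a\<in>UNIV. pmf (\<pi> k t s) a * sqrt (q_hat M (\<pi> k) t s a))\<^sup>2)
        - ereal ((1 - c) * Delta M K \<pi> k t s)
      \<le> ereal (\<Sum>a\<in>UNIV. pmf (\<pi> k t s) a * q_hat M (\<pi> k) t s a)"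
    and "t \<le> horizon M"
  shows "c * PDIS_variance M (\<pi> k) (mu_hat M K \<pi>) t s \<le> PDIS_variance M (\<pi> k) (\<pi> k) t s"
  using \<open>t \<le> horizon M\<close>
proof (induction arbitrary: s rule: inc_induct)
  case base
  then show ?case by (simp add: PDIS_variance_horizon)
next
  case (step t)
  let ?\<mu> = "mu_hat M K \<pi>"
  let ?\<rho> = "is_ratio (\<pi> k) ?\<mu> t s" and ?q = "action_value M (\<pi> k) t s"
    and ?\<nu> = "nu M (\<pi> k) t s" and ?v = "state_value M (\<pi> k) t s"
  let ?E = "measure_pmf.expectation (?\<mu> t s)"
  let ?On = "\<lambda>a. measure_pmf.expectation (transition M s a) (PDIS_variance M (\<pi> k) (\<pi> k) (Suc t))"
  let ?Off = "\<lambda>a. measure_pmf.expectation (transition M s a) (PDIS_variance M (\<pi> k) ?\<mu> (Suc t))"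
  note t = step.hyps(2)
  have int: "integrable (?\<mu> t s) f" for f :: "'a \<Rightarrow> real"
    by (simp add: integrable_measure_pmf_finite)
  have Delta: "Delta M K \<pi> k t s
      = ?E (\<lambda>a. (?\<rho> a)\<^sup>2 * ?\<nu> a) + (?E (\<lambda>a. (?\<rho> a)\<^sup>2 * (?q a)\<^sup>2) - ?v\<^sup>2)"
    unfolding Delta_def
    by (subst variance_pmf_finite)
       (simp_all add: expectation_ratio_action_value[OF covers_mu_hat[OF k] t] power_mult_distrib)
  \<comment> \<open>\<open>Delta\<close> is exactly the variance created in the first step, so the
    induction hypothesis only has to treat the later variance.\<close>
  have off: "PDIS_variance M (\<pi> k) ?\<mu> t s = Delta M K \<pi> k t s + ?E (\<lambda>a. (?\<rho> a)\<^sup>2 * ?Off a)"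
    unfolding PDIS_variance_step[OF covers_mu_hat[OF k] t] Delta_def
    by (simp add: distrib_left int)
  have q_hat: "?E (\<lambda>a. (?\<rho> a)\<^sup>2 * q_hat M (\<pi> k) t s a)
      = Delta M K \<pi> k t s + ?v\<^sup>2 + ?E (\<lambda>a. (?\<rho> a)\<^sup>2 * ?On a)"
    unfolding q_hat_eq Delta by (simp add: distrib_left int)
  have "c * ?E (\<lambda>a. (?\<rho> a)\<^sup>2 * ?Off a) \<le> ?E (\<lambda>a. (?\<rho> a)\<^sup>2 * ?On a)"
  proof -
    have "c * ?Off a \<le> ?On a" for a
      unfolding expectation_pmf_UNIV sum_distrib_left
      using step.IH
      by (intro sum_mono, subst mult.left_commute) (auto intro: mult_left_mono)
    then have "?E (\<lambda>a. (?\<rho> a)\<^sup>2 * (c * ?Off a)) \<le> ?E (\<lambda>a. (?\<rho> a)\<^sup>2 * ?On a)"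
      by (intro integral_mono int mult_left_mono) auto
    then show ?thesis by (simp add: mult.left_commute)
  qed
  \<comment> \<open>Of the term \<open>c * Delta\<close>, a full \<open>Delta\<close> goes into the
    mean of \<open>q_hat\<close>; the excess is the correction \<open>(1 - c) * Delta\<close> of the
    similarity condition.\<close>
  then have "c * PDIS_variance M (\<pi> k) ?\<mu> t s
      \<le> ?E (\<lambda>a. (?\<rho> a)\<^sup>2 * q_hat M (\<pi> k) t s a) - (1 - c) * Delta M K \<pi> k t s - ?v\<^sup>2"
    unfolding off q_hat by (simp add: algebra_simps)
  also have "\<dots> \<le> (\<Sum>a\<in>UNIV. pmf (\<pi> k t s) a * q_hat M (\<pi> k) t s a) - ?v\<^sup>2"
    using second_moment_mu_hat_le_similarity[OF k sim[OF t], of s] by (simp add: expectation_pmf_UNIV)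
  also have "\<dots> = PDIS_variance M (\<pi> k) (\<pi> k) t s"
    by (rule PDIS_variance_on_policy[OF t, symmetric])
  finally show ?case .
qed

end

theorem theorem3:
  fixes M :: "('s::finite, 'a::finite) mdp"
    and K :: nat
    and \<pi> :: "nat \<Rightarrow> ('s, 'a) policy"
    and N :: "nat \<Rightarrow> nat"
    and n :: nat
  assumes N_pos: "\<forall>k\<in>{1..K}. 0 < N k"
    and n_eq: "n = (\<Sum>k = 1..K. N k)"
    and similarity: "\<forall>k\<in>{1..K}. \<forall>t<horizon M. \<forall>s.
      sqrt_eta_ratio M K \<pi> t *
          ereal ((\<Sum>a\<in>UNIV. pmf (\<pi> k t s) a * sqrt (q_hat M (\<pi> k) t s a))\<^sup>2)
        - ereal ((1 - real (N k) / real n) * Delta M K \<pi> k t s)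
      \<le> ereal (\<Sum>a\<in>UNIV. pmf (\<pi> k t s) a * q_hat M (\<pi> k) t s a)"
  shows "\<forall>k\<in>{1..K}. \<forall>t<horizon M. \<forall>s.
      measure_pmf.variance (segments_pmf M (mu_hat M K \<pi>) n t s)
        (empirical_mean M (\<pi> k) (mu_hat M K \<pi>) n t)
      \<le> measure_pmf.variance (segments_pmf M (\<pi> k) (N k) t s)
          (empirical_mean M (\<pi> k) (\<pi> k) (N k) t)"
proof (intro ballI allI impI)
  fix k t s
  assume k: "k \<in> {1..K}" and t: "t < horizon M"
  have N: "0 < N k" using N_pos k by blast
  have "N k \<le> n" unfolding n_eq using k by (intro member_le_sum) auto
  with N have n: "0 < n" by simp
  \<comment> \<open>The constant is the quotient of the two sample sizes, so dividing by
    \<open>N k\<close> yields the claim for the averages.\<close>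
  have "real (N k) / real n * PDIS_variance M (\<pi> k) (mu_hat M K \<pi>) t s \<le> PDIS_variance M (\<pi> k) (\<pi> k) t s"
    using similarity k t by (intro PDIS_variance_mu_hat_le) auto
  then show "measure_pmf.variance (segments_pmf M (mu_hat M K \<pi>) n t s)
        (empirical_mean M (\<pi> k) (mu_hat M K \<pi>) n t)
      \<le> measure_pmf.variance (segments_pmf M (\<pi> k) (N k) t s)
          (empirical_mean M (\<pi> k) (\<pi> k) (N k) t)"
    unfolding variance_empirical_mean PDIS_variance_def[symmetric]
    using N n by (simp add: field_simps)
qed

end
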